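(* Let $\mathfrak A=(A,Q)$ be a finite quadratic module of level $N$ with even signature, and let $G_N=\mathrm{SL}_2(\mathbb Z/N\mathbb Z)$ act on $\mathbb C[A]$ via the Weil representation $\rho_{\mathfrak A}$. Then the space of invariants $\mathbb C[A]^{G_N}$ is defined over $\mathbb Z$, i.e. it possesses a $\mathbb C$-basis consisting of elements of $\mathbb Z[A]=\bigoplus_{x\in A}\mathbb Z\mathfrak e_x$.
   Context: A finite quadratic module is a pair $\mathfrak A=(A,Q)$ with $A$ a finite abelian group and $Q:A\to\mathbb Q/\mathbb Z$ a quadratic form whose associated bilinear form $Q(x,y)=Q(x+y)-Q(x)-Q(y)$ is non-degenerate. Its level is $N=\min\{n\ge1: nQ(x)\in\mathbb Z\ \forall x\in A\}$. Write $e(z)=e^{2\pi i z}$. The signature $\operatorname{sig}(\mathfrak A)\in\mathbb Z/8\mathbb Z$ is defined by $|A|^{-1/2}\sum_{x\in A}e(Q(x))=e(\operatorname{sig}(\mathfrak A)/8)$. Let $(\mathfrak e_x)_{x\in A}$ be the standard basis of $\mathbb C[A]$. The Weil representation is given by $\rho_{\mathfrak A}(T)\mathfrak e_x=e(Q(x))\mathfrak e_x$ and $\rho_{\mathfrak A}(S)\mathfrak e_x=\frac{e(-\operatorname{sig}(\mathfrak A)/8)}{\sqrt{|A|}}\sum_{y\in A}e(-Q(x,y))\mathfrak e_y$ for $T=\begin{pmatrix}1&1\\0&1\end{pmatrix}$, $S=\begin{pmatrix}0&-1\\1&0\end{pmatrix}$; for even signature it is a representation of $\mathrm{SL}_2(\mathbb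 Z)$ factoring through $\mathrm{SL}_2(\mathbb Z/N\mathbb Z)$. *)

theory Defs
  imports "HOL-Analysis.Analysis" "HOL-Algebra.Group"
begin

quotient_type rat_mod_int = rat / "\<lambda>x y. x - y \<in> \<int>"
proof (rule equivpI)
  show "reflp (\<lambda>x y::rat. x - y \<in> \<int>)"
    by (simp add: reflp_def)
  show "symp (\<lambda>x y::rat. x - y \<in> \<int>)"
    unfolding symp_def by (metis Ints_minus minus_diff_eq)
  show "transp (\<lambda>x y::rat. x - y \<in> \<int>)"
    unfolding transp_def by (metis Ints_add diff_add_cancel add_diff_eq)
qed

instantiation rat_mod_int :: ab_group_add
begin

lift_definition zero_rat_mod_int :: rat_mod_int is 0 .

lift_definition plus_rat_mod_int :: "rat_mod_int \<Rightarrow> rat_mod_int \<Rightarrow> rat_mod_int" is "(+)"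
  by (metis Ints_add add_diff_add)

lift_definition uminus_rat_mod_int :: "rat_mod_int \<Rightarrow> rat_mod_int" is uminus
  by (metis Ints_minus minus_diff_minus)

lift_definition minus_rat_mod_int :: "rat_mod_int \<Rightarrow> rat_mod_int \<Rightarrow> rat_mod_int" is "(-)"
  by (metis Ints_diff diff_diff_eq2 diff_diff_eq add.commute diff_add_eq)

instance
  by (standard; transfer; simp add: algebra_simps)

end

lift_definition e :: "rat_mod_int \<Rightarrow> complex" is "\<lambda>q. exp (2 * of_real pi * \<i> * of_rat q)"
proof -
  fix q r :: rat
  assume "q - r \<in> \<int>"
  then obtain n :: int where "q = r + of_int n"
    by (metis Ints_cases add.commute diff_add_cancel)
  then show "exp (2 * of_real pi * \<i> * of_rat q) = exp (2 * of_real pi * \<i> * of_rat r)"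
    using exp_plus_2pin[of "2 * of_real pi * \<i> * of_rat r" n]
    by (simp add: of_rat_add algebra_simps)
qed

definition int_multiple :: "int \<Rightarrow> 'a::ab_group_add \<Rightarrow> 'a" where
  "int_multiple n x = (\<Sum>i<nat n. x) - (\<Sum>i<nat (- n). x)"

definition bilinear_form :: "('a::ab_group_add \<Rightarrow> rat_mod_int) \<Rightarrow> 'a \<Rightarrow> 'a \<Rightarrow> rat_mod_int" where
  "bilinear_form Q x y = Q (x + y) - Q x - Q y"

definition quadratic_form :: "('a::ab_group_add \<Rightarrow> rat_mod_int) \<Rightarrow> bool" where
  "quadratic_form Q \<longleftrightarrow>
     (\<forall>n x. Q (int_multiple n x) = int_multiple (n\<^sup>2) (Q x)) \<and>
     (\<forall>x y z. bilinear_form Q (x + y) z = bilinear_form Q x z + bilinear_form Q y z) \<and>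
     (\<forall>x y z. bilinear_form Q x (y + z) = bilinear_form Q x y + bilinear_form Q x z)"

definition finite_quadratic_module :: "('a::{finite,ab_group_add} \<Rightarrow> rat_mod_int) \<Rightarrow> bool" where
  "finite_quadratic_module Q \<longleftrightarrow>
     quadratic_form Q \<and> (\<forall>x. (\<forall>y. bilinear_form Q x y = 0) \<longrightarrow> x = 0)"

definition level :: "('a::{finite,ab_group_add} \<Rightarrow> rat_mod_int) \<Rightarrow> nat" where
  "level Q = (LEAST n. n \<ge> 1 \<and> (\<forall>x. int_multiple (int n) (Q x) = 0))"

text \<open>The signature is an element of the integers modulo 8; \<open>has_signature Q s\<close> says that the
  integer \<open>s\<close> represents it.\<close>

definition has_signature :: "('a::{finite,ab_group_add} \<Rightarrow> rat_mod_int) \<Rightarrow> int \<Rightarrow> bool" where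
  "has_signature Q s \<longleftrightarrow>
     (1 / of_real (sqrt (real CARD('a)))) * (\<Sum>x\<in>UNIV. e (Q x)) =
       exp (2 * of_real pi * \<i> * (of_int s / 8))"

definition reduce_mod :: "nat \<Rightarrow> int^2^2 \<Rightarrow> int^2^2" where
  "reduce_mod N M = (\<chi> i j. M $ i $ j mod int N)"

text \<open>Residue classes are represented by their least non-negative representatives. The formulation
  covers \<open>N = 1\<close>, where the group is trivial.\<close>

definition SL2_mod :: "nat \<Rightarrow> (int^2^2) monoid" where
  "SL2_mod N =
     \<lparr>carrier = {M. (\<forall>i j. M $ i $ j \<in> {0..<int N}) \<and> det M mod int N = 1 mod int N},
      mult = (\<lambda>M M'. reduce_mod N (M ** M')),
      one = reduce_mod N (mat 1)\<rparr>"

definition S_matrix :: "int^2^2" where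
  "S_matrix = vector [vector [0, -1], vector [1, 0]]"

definition T_matrix :: "int^2^2" where
  "T_matrix = vector [vector [1, 1], vector [0, 1]]"

lemma reduce_mod_mult:
  "reduce_mod N (reduce_mod N A ** B) = reduce_mod N (A ** B)"
  "reduce_mod N (A ** reduce_mod N B) = reduce_mod N (A ** B)"
  by (simp_all add: reduce_mod_def matrix_matrix_mult_def vec_eq_iff sum_2)
    (intro allI mod_add_cong mod_mult_cong; simp)+

lemma det_reduce_mod: "det (reduce_mod N A) mod int N = det A mod int N"
  by (simp add: reduce_mod_def det_2) (intro mod_diff_cong mod_mult_cong; simp)

lemma reduce_mod_id:
  "(\<forall>i j. A $ i $ j \<in> {0..<int N}) \<Longrightarrow> reduce_mod N A = A"
  by (simp add: reduce_mod_def vec_eq_iff)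

lemma reduce_mod_in_SL2_mod:
  assumes "N \<ge> 1" "det A mod int N = 1 mod int N"
  shows "reduce_mod N A \<in> carrier (SL2_mod N)"
  using assms det_reduce_mod[of N A] by (simp add: SL2_mod_def) (simp add: reduce_mod_def)

lemma group_SL2_mod:
  assumes N: "N \<ge> 1"
  shows "group (SL2_mod N)"
proof (rule groupI)
  fix A B
  assume A: "A \<in> carrier (SL2_mod N)" and B: "B \<in> carrier (SL2_mod N)"
  have "det (A ** B) mod int N = (det A mod int N) * (det B mod int N) mod int N"
    by (simp add: det_mul mod_simps)
  also have "\<dots> = 1 mod int N"
    using A B by (simp add: SL2_mod_def mod_simps)
  finally show "A \<otimes>\<^bsub>SL2_mod N\<^esub> B \<in> carrier (SL2_mod N)"
    using reduce_mod_in_SL2_mod[OF N] by (simp add: SL2_mod_def)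
next
  show "\<one>\<^bsub>SL2_mod N\<^esub> \<in> carrier (SL2_mod N)"
    using reduce_mod_in_SL2_mod[OF N, of "mat 1"] by (simp add: SL2_mod_def)
next
  fix A B C
  show "A \<otimes>\<^bsub>SL2_mod N\<^esub> B \<otimes>\<^bsub>SL2_mod N\<^esub> C = A \<otimes>\<^bsub>SL2_mod N\<^esub> (B \<otimes>\<^bsub>SL2_mod N\<^esub> C)"
    by (simp add: SL2_mod_def reduce_mod_mult matrix_mul_assoc)
next
  fix A
  assume "A \<in> carrier (SL2_mod N)"
  then show "\<one>\<^bsub>SL2_mod N\<^esub> \<otimes>\<^bsub>SL2_mod N\<^esub> A = A"
    by (simp add: SL2_mod_def reduce_mod_mult reduce_mod_id)
next
  fix A
  assume A: "A \<in> carrier (SL2_mod N)"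
  define B :: "int^2^2" where "B = vector [vector [A$2$2, - A$1$2], vector [- A$2$1, A$1$1]]"
  have "B ** A = mat (det A)"
    by (simp add: B_def matrix_matrix_mult_def mat_def vec_eq_iff sum_2 forall_2 det_2 algebra_simps)
  then have "reduce_mod N (B ** A) = reduce_mod N (mat 1)"
    using A by (simp add: SL2_mod_def reduce_mod_def mat_def vec_eq_iff)
  moreover have "det B = det A"
    by (simp add: B_def det_2 algebra_simps)
  ultimately show "\<exists>B\<in>carrier (SL2_mod N). B \<otimes>\<^bsub>SL2_mod N\<^esub> A = \<one>\<^bsub>SL2_mod N\<^esub>"
    using A reduce_mod_in_SL2_mod[OF N, of B]
    by (intro bexI[of _ "reduce_mod N B"]) (auto simp: SL2_mod_def reduce_mod_mult)
qed

lemma S_T_in_SL2_mod: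
  assumes "N \<ge> 1"
  shows "reduce_mod N S_matrix \<in> carrier (SL2_mod N)"
    and "reduce_mod N T_matrix \<in> carrier (SL2_mod N)"
  by (intro reduce_mod_in_SL2_mod[OF assms]; simp add: S_matrix_def T_matrix_def det_2)+

text \<open>The space \<open>complex^'a\<close> is the group algebra, with \<open>axis x 1\<close> as the basis vector belonging to
  \<open>x\<close>. Scalar multiplication over the complex numbers is \<open>(*s)\<close>, and the constants
  prefixed by \<open>vec\<close> refer to this structure.\<close>

definition GL :: "(complex^'a^'a) monoid" where
  "GL = \<lparr>carrier = {M. invertible M}, mult = (**), one = mat 1\<rparr>"

text \<open>The homomorphism is determined by its values at the images of \<open>S\<close> and \<open>T\<close>, because these
  generate the special linear group modulo the level.\<close>

definition weil_representation ::
    "('a::{finite,ab_group_add} \<Rightarrow> rat_mod_int) \<Rightarrow> int \<Rightarrow> (int^2^2 \<Rightarrow> complex^'a::{finite,ab_group_add}^'a::{finite,ab_group_add}) \<Rightarrow> bool" where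
  "weil_representation Q s \<rho> \<longleftrightarrow>
     \<rho> \<in> hom (SL2_mod (level Q)) GL \<and>
     (\<forall>x. \<rho> (reduce_mod (level Q) T_matrix) *v axis x 1 = e (Q x) *s axis x 1) \<and>
     (\<forall>x. \<rho> (reduce_mod (level Q) S_matrix) *v axis x 1 =
            (exp (- (2 * of_real pi * \<i> * (of_int s / 8))) / of_real (sqrt (real CARD('a)))) *s
            (\<Sum>y\<in>UNIV. e (- bilinear_form Q x y) *s axis y 1))"

definition invariants ::
    "nat \<Rightarrow> (int^2^2 \<Rightarrow> complex^'a::finite^'a::finite) \<Rightarrow> (complex^'a) set" where
  "invariants N \<rho> = {v. \<forall>g\<in>carrier (SL2_mod N). \<rho> g *v v = v}"

definition integral_vectors :: "(complex^'a::finite) set" where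
  "integral_vectors = {v. \<forall>x. v $ x \<in> \<int>}"

definition defined_over_int :: "(complex^'a::finite) set \<Rightarrow> bool" where
  "defined_over_int V \<longleftrightarrow>
     (\<exists>B. B \<subseteq> integral_vectors \<and> vec.independent B \<and> vec.span B = V)"

end

theory Submission
  imports Defs "HOL-Number_Theory.Cong"
begin

text \<open>
  The sum \<open>P\<close> of all \<open>\<rho> g\<close> has the space of invariants as its range, so it suffices that its
  entries are rational: suitable integer multiples of its columns are then integral and span the invariants.
  Replacing \<open>Q\<close> by \<open>a Q\<close> for \<open>a\<close> prime to the level amounts to a Galois conjugation of the
  entries of \<open>\<rho> g\<close>, and on the other hand to precomposing \<open>\<rho>\<close> with conjugation by the
  matrix \<open>diag(a, 1)\<close>, which permutes the group; it is enough to check this for \<open>S\<close> and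
  \<open>T\<close>. So \<open>P\<close> equals its average over all such \<open>a\<close>, and this average is rational because
  Ramanujan sums are.
\<close>

subsection \<open>Multiples in the rationals modulo the integers\<close>

lemma int_multiple_0 [simp]: "int_multiple 0 x = 0"
  by (simp add: int_multiple_def)

lemma int_multiple_1 [simp]: "int_multiple 1 x = x"
  by (simp add: int_multiple_def)

lemma int_multiple_plus_1: "int_multiple (n + 1) x = int_multiple n x + x"
proof (cases "n \<ge> 0")
  case True
  then show ?thesis by (simp add: int_multiple_def nat_add_distrib)
next
  case False
  then have "nat (- n) = Suc (nat (- (n + 1)))" by simp
  with False show ?thesis by (simp only: int_multiple_def) (simp add: algebra_simps)
qed

lemma int_multiple_add: "int_multiple (m + n) x = int_multiple m x + int_multiple n x"
proof (induction n rule: int_induct[where k = 0])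
  case (step1 i)
  then show ?case using int_multiple_plus_1[of "m + i" x] int_multiple_plus_1[of i x]
    by (simp add: algebra_simps)
next
  case (step2 i)
  then show ?case using int_multiple_plus_1[of "m + (i - 1)" x] int_multiple_plus_1[of "i - 1" x]
    by (simp add: algebra_simps)
qed simp

lemma int_multiple_minus: "int_multiple (- n) x = - int_multiple n x"
  using int_multiple_add[of n "- n" x] by (simp add: eq_neg_iff_add_eq_0 add.commute)

lemma int_multiple_add_right: "int_multiple n (x + y) = int_multiple n x + int_multiple n y"
  by (simp add: int_multiple_def sum.distrib)

lemma int_multiple_zero_right [simp]: "int_multiple n 0 = 0"
  by (simp add: int_multiple_def)

lemma int_multiple_minus_right: "int_multiple n (- x) = - int_multiple n x"
  by (simp add: int_multiple_def sum_negf)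

lemma int_multiple_diff_right: "int_multiple n (x - y) = int_multiple n x - int_multiple n y"
  using int_multiple_add_right[of n x "- y"] by (simp add: int_multiple_minus_right)

lemma int_multiple_mult: "int_multiple (m * n) x = int_multiple m (int_multiple n x)"
proof (induction m rule: int_induct[where k = 0])
  case (step1 i)
  then show ?case by (simp add: int_multiple_add algebra_simps)
next
  case (step2 i)
  then show ?case using int_multiple_add[of "i - 1" 1 "int_multiple n x"]
      int_multiple_add[of "(i - 1) * n" n x]
    by (simp add: algebra_simps)
qed simp

lemma int_multiple_cong:
  assumes "[m = n] (mod k)" and "int_multiple k x = 0"
  shows "int_multiple m x = int_multiple n x"
proof -
  obtain l where "m = n + l * k"
    using assms(1) by (metis cong_iff_lin cong_sym mult.commute)
  then show ?thesis
    using assms(2) by (simp add: int_multiple_add int_multiple_mult)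
qed

section \<open>The character \<open>e\<close> of the rationals modulo the integers\<close>

lemma of_real_of_rat: "of_real (of_rat q) = (of_rat q :: complex)"
  by (cases q) (simp add: of_rat_rat)

lemma e_0 [simp]: "e 0 = 1"
  by transfer simp

lemma e_add: "e (p + q) = e p * e q"
  by transfer (simp add: of_rat_add algebra_simps exp_add)

lemma e_minus: "e (- q) = cnj (e q)"
  by transfer (simp add: of_rat_minus exp_cnj flip: of_real_of_rat)

lemma e_eq_1_iff: "e q = 1 \<longleftrightarrow> q = 0"
proof
  show "e q = 1 \<Longrightarrow> q = 0"
  proof transfer
    fix q :: rat
    assume "exp (2 * of_real pi * \<i> * of_rat q) = (1 :: complex)"
    then obtain n :: int where "2 * pi * of_rat q = of_int (2 * n) * pi"
      by (auto simp: exp_eq_1 simp flip: of_real_of_rat)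
    then have "of_rat q = (of_rat (of_int n) :: real)" by simp
    then have "q = of_int n" by (simp only: of_rat_eq_iff)
    then show "q - 0 \<in> \<int>" by simp
  qed
qed simp

lemma e_int_multiple_of_nat: "e (int_multiple (int n) q) = e q ^ n"
  by (induction n) (simp_all add: int_multiple_add e_add)

definition e_mult :: "int \<Rightarrow> rat_mod_int \<Rightarrow> complex" where
  "e_mult a q = e (int_multiple a q)"

lemma e_mult_add: "e_mult a (p + q) = e_mult a p * e_mult a q"
  by (simp add: e_mult_def int_multiple_add_right e_add)

lemma e_mult_minus: "e_mult a (- q) = cnj (e_mult a q)"
  by (simp add: e_mult_def int_multiple_minus_right e_minus)

lemma e_mult_uminus: "e_mult (- a) q = cnj (e_mult a q)"
  by (simp add: e_mult_def int_multiple_minus e_minus)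

lemma e_mult_0 [simp]: "e_mult a 0 = 1" "e_mult 0 q = 1"
  by (simp_all add: e_mult_def)

lemma e_mult_cnj_mult [simp]: "e_mult a q * cnj (e_mult a q) = 1"
  using e_mult_add[of a q "- q"] by (simp add: e_mult_minus)

lemma e_mult_add_left: "e_mult (a + b) q = e_mult a q * e_mult b q"
  by (simp add: e_mult_def int_multiple_add e_add)

text \<open>The denominator of any rational representative annihilates the class. This is what
  guarantees that the minimum defining \<open>level\<close> is attained.\<close>

lemma int_multiple_eq_0_exists: "\<exists>n\<ge>1. int_multiple (int n) (q :: rat_mod_int) = 0"
proof -
  obtain r where q: "q = abs_rat_mod_int r"
    by (metis Quotient_abs_rep Quotient_rat_mod_int)
  have *: "int_multiple (int n) (abs_rat_mod_int r) = abs_rat_mod_int (of_nat n * r)" for n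
    by (induction n)
      (simp_all add: int_multiple_add zero_rat_mod_int_def plus_rat_mod_int.abs_eq algebra_simps)
  obtain a b where ab: "quotient_of r = (a, b)" by force
  then have "b > 0" "r = of_int a / of_int b"
    by (auto intro: quotient_of_denom_pos quotient_of_div)
  then have "of_nat (nat b) * r = of_int a" by simp
  then have "int_multiple (int (nat b)) q = 0"
    unfolding q * by (simp add: zero_rat_mod_int_def rat_mod_int.abs_eq_iff)
  then show ?thesis using \<open>b > 0\<close> by (intro exI[of _ "nat b"]) auto
qed

subsection \<open>Rationality of Galois averages\<close>

text \<open>A geometric sum: for \<open>q\<close> nonzero, \<open>e q\<close> is an
  \<open>N\<close>-th root of unity other than 1 and the sum vanishes; for \<open>q = 0\<close> it
  is \<open>N\<close>.\<close>

lemma sum_e_multiples_rational: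
  assumes "int_multiple (int N) q = 0"
  shows "(\<Sum>a<N. e (int_multiple (int a) q)) \<in> \<rat>"
proof (cases "q = 0")
  case False
  have "e q ^ N = 1" using assms e_int_multiple_of_nat[of N q] by simp
  then show ?thesis
    using False by (simp add: e_int_multiple_of_nat sum_gp_strict e_eq_1_iff)
qed simp

text \<open>Sorting \<open>a < N\<close> by \<open>gcd a N\<close> expresses the Ramanujan sum through the full
  sum over residues and Ramanujan sums for proper divisors of \<open>N\<close>.\<close>

lemma ramanujan_sum_rational:
  assumes "N > 0" and "int_multiple (int N) q = 0"
  shows "(\<Sum>a\<in>{a. a < N \<and> coprime a N}. e (int_multiple (int a) q)) \<in> \<rat>"
  using assms
proof (induction N arbitrary: q rule: less_induct)
  case (less N)
  define X where "X d = (\<Sum>a\<in>{a. a < N \<and> gcd a N = d}. e (int_multiple (int a) q))" for d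
  have X_rational: "X d \<in> \<rat>" if d: "d dvd N" "d \<noteq> 1" for d
  proof -
    obtain m where N: "N = d * m" using d(1) by blast
    have pos: "d > 0" "m > 0" using N less.prems(1) by auto
    \<comment> \<open>Writing a = d c makes \<open>X d\<close> a Ramanujan sum modulo m = N / d for
      the element \<open>d q\<close>. It is annihilated by \<open>m\<close>, and m < N since d is
      not 1, so the induction hypothesis applies.\<close>
    have "X d = (\<Sum>a\<in>{a. a < m \<and> coprime a m}. e (int_multiple (int a) (int_multiple (int d) q)))"
      unfolding X_def
    proof (rule sum.reindex_bij_witness[of _ "\<lambda>a. d * a" "\<lambda>a. a div d"])
      fix a assume a: "a \<in> {a. a < N \<and> gcd a N = d}"
      then have "d dvd a" by auto
      then obtain c where c: "a = d * c" by blast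
      then have "gcd a N = d * gcd c m" by (simp add: N gcd_mult_distrib_nat)
      with a pos have "coprime c m" by (simp add: coprime_iff_gcd_eq_1)
      then show "a div d \<in> {a. a < m \<and> coprime a m}" using a c pos by (simp add: N)
      show "d * (a div d) = a" using c pos by simp
      show "e (int_multiple (int (a div d)) (int_multiple (int d) q)) = e (int_multiple (int a) q)"
        using c pos by (simp add: mult.commute flip: int_multiple_mult)
    qed (use pos N in \<open>auto simp: gcd_mult_distrib_nat[symmetric]\<close>)
    moreover have "m < N" using d pos N by (cases d) auto
    moreover have "int_multiple (int m) (int_multiple (int d) q) = 0"
      using less.prems(2) by (simp add: N mult.commute flip: int_multiple_mult)
    ultimately show ?thesis using less.IH pos by simp
  qed
  have fin: "finite {d. d dvd N}" using less.prems(1) by simp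
  have "(\<Sum>a<N. e (int_multiple (int a) q)) = (\<Sum>d\<in>{d. d dvd N}. X d)"
    unfolding X_def using sum.group[of "{..<N}" "{d. d dvd N}" "\<lambda>a. gcd a N" "\<lambda>a. e (int_multiple (int a) q)"] fin
    by (force simp: image_subset_iff)
  also have "\<dots> = X 1 + (\<Sum>d\<in>{d. d dvd N} - {1}. X d)"
    using fin by (intro sum.remove) auto
  finally have "X 1 = (\<Sum>a<N. e (int_multiple (int a) q)) - (\<Sum>d\<in>{d. d dvd N} - {1}. X d)"
    by simp
  moreover have "(\<Sum>d\<in>{d. d dvd N} - {1}. X d) \<in> \<rat>"
    by (intro Rats_sum X_rational) auto
  ultimately have "X 1 \<in> \<rat>"
    using sum_e_multiples_rational[OF less.prems(2)] by simp
  then show ?case by (simp add: X_def coprime_iff_gcd_eq_1)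
qed

text \<open>A family \<open>f\<close> stands for an element of the cyclotomic field of order \<open>N\<close> together with
  its conjugates: \<open>f a\<close> is obtained from \<open>f 1\<close> by raising roots of unity to the \<open>a\<close>-th power.
  Carrying all conjugates along avoids proving that this is a well-defined automorphism.\<close>

inductive conjugate_family :: "nat \<Rightarrow> (nat \<Rightarrow> complex) \<Rightarrow> bool" for N where
  monomial: "int_multiple (int N) q = 0 \<Longrightarrow> r \<in> \<rat> \<Longrightarrow>
    conjugate_family N (\<lambda>a. r * e (int_multiple (int a) q))"
| add: "conjugate_family N f \<Longrightarrow> conjugate_family N g \<Longrightarrow> conjugate_family N (\<lambda>a. f a + g a)"

lemma conjugate_family_const: "r \<in> \<rat> \<Longrightarrow> conjugate_family N (\<lambda>a. r)"
  using conjugate_family.monomial[of N 0 r] by simp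

lemma conjugate_family_e:
  "int_multiple (int N) q = 0 \<Longrightarrow> conjugate_family N (\<lambda>a. e (int_multiple (int a) q))"
  using conjugate_family.monomial[of N q 1] by simp

lemma conjugate_family_sum:
  assumes "\<And>i. i \<in> I \<Longrightarrow> conjugate_family N (f i)"
  shows "conjugate_family N (\<lambda>a. \<Sum>i\<in>I. f i a)"
  using assms
  by (induction I rule: infinite_finite_induct)
    (auto intro: conjugate_family_const conjugate_family.add)

text \<open>Two monomials multiply to a monomial whose root of unity belongs to
  \<open>q + q'\<close>; distributivity does the rest.\<close>

lemma conjugate_family_mult:
  assumes "conjugate_family N f" "conjugate_family N g"
  shows "conjugate_family N (\<lambda>a. f a * g a)"
  using assms
proof (induction f)
  case (monomial q r)
  from monomial(3) show ?case
  proof (induction g)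
    case (monomial q' r')
    have "conjugate_family N (\<lambda>a. (r * r') * e (int_multiple (int a) (q + q')))"
      using monomial \<open>r \<in> \<rat>\<close> \<open>int_multiple (int N) q = 0\<close>
      by (intro conjugate_family.monomial) (auto simp: int_multiple_add_right)
    then show ?case by (simp add: int_multiple_add_right e_add mult_ac)
  next
    case (add g h)
    then show ?case using conjugate_family.add by (fastforce simp: distrib_left)
  qed
next
  case (add f h)
  then show ?case using conjugate_family.add by (fastforce simp: distrib_right)
qed

lemma conjugate_family_sum_rational:
  assumes "conjugate_family N f" "N > 0"
  shows "(\<Sum>a\<in>{a. a < N \<and> coprime a N}. f a) \<in> \<rat>"
  using assms(1)
proof induction
  case (monomial q r)
  then show ?case
    using ramanujan_sum_rational[OF assms(2), of q] by (simp flip: sum_distrib_left)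
qed (simp add: sum.distrib)

text \<open>Plays the part of Galois descent: if all conjugates equal \<open>z\<close>, their
  rational sum is \<open>z\<close> times the number of units modulo \<open>N\<close>.\<close>

lemma conjugate_family_fixed_rational:
  assumes "conjugate_family N f" "N > 0"
    and "\<And>a. coprime a N \<Longrightarrow> f a = z"
  shows "z \<in> \<rat>"
proof -
  let ?U = "{a. a < N \<and> coprime a N}"
  \<comment> \<open>Not simply 1, because for N = 1 the only element of \<open>?U\<close> is
    0.\<close>
  have "1 mod N \<in> ?U" using \<open>N > 0\<close> by (simp add: coprime_commute)
  then have "card ?U \<noteq> 0" by (auto simp: card_eq_0_iff)
  moreover have "of_nat (card ?U) * z \<in> \<rat>"
    using conjugate_family_sum_rational[OF assms(1,2)] assms(3) by simp
  ultimately show ?thesis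
    using Rats_divide[of "of_nat (card ?U) * z" "of_nat (card ?U)"] by simp
qed

subsection \<open>The special linear group modulo \<open>N\<close>\<close>

definition mat2 :: "int \<Rightarrow> int \<Rightarrow> int \<Rightarrow> int \<Rightarrow> int^2^2" where
  "mat2 p q r t = vector [vector [p, q], vector [r, t]]"

lemma mat2_nth [simp]:
  "mat2 p q r t $ 1 $ 1 = p" "mat2 p q r t $ 1 $ 2 = q"
  "mat2 p q r t $ 2 $ 1 = r" "mat2 p q r t $ 2 $ 2 = t"
  by (simp_all add: mat2_def)

lemma mat2_eqI:
  "M $ 1 $ 1 = p \<Longrightarrow> M $ 1 $ 2 = q \<Longrightarrow> M $ 2 $ 1 = r \<Longrightarrow> M $ 2 $ 2 = t \<Longrightarrow> M = mat2 p q r t"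
  by (simp add: vec_eq_iff forall_2)

lemma mat2_eta: "mat2 (M $ 1 $ 1) (M $ 1 $ 2) (M $ 2 $ 1) (M $ 2 $ 2) = M"
  by (rule mat2_eqI[symmetric]) auto

lemma mat2_mult [simp]:
  "mat2 p q r t ** mat2 p' q' r' t' = mat2 (p * p' + q * r') (p * q' + q * t') (r * p' + t * r') (r * q' + t * t')"
  by (intro mat2_eqI) (simp_all add: matrix_matrix_mult_def sum_2)

lemma det_mat2 [simp]: "det (mat2 p q r t) = p * t - q * r"
  by (simp add: det_2)

lemma S_matrix_eq: "S_matrix = mat2 0 (- 1) 1 0"
  by (simp add: S_matrix_def mat2_def)

lemma T_matrix_eq: "T_matrix = mat2 1 1 0 1"
  by (simp add: T_matrix_def mat2_def)

lemma reduce_mod_mat2: "reduce_mod N (mat2 p q r t) = mat2 (p mod int N) (q mod int N) (r mod int N) (t mod int N)"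
  by (intro mat2_eqI) (simp_all add: reduce_mod_def)

lemma mat2_eq_iff: "mat2 p q r t = mat2 p' q' r' t' \<longleftrightarrow> p = p' \<and> q = q' \<and> r = r' \<and> t = t'"
  by (metis mat2_nth)

lemma reduce_mod_mat2_eq_iff:
  "reduce_mod N (mat2 p q r t) = reduce_mod N (mat2 p' q' r' t') \<longleftrightarrow>
     [p = p'] (mod int N) \<and> [q = q'] (mod int N) \<and> [r = r'] (mod int N) \<and> [t = t'] (mod int N)"
  by (simp add: reduce_mod_mat2 mat2_eq_iff cong_def)

lemma mult_SL2_mod: "A \<otimes>\<^bsub>SL2_mod N\<^esub> B = reduce_mod N (A ** B)"
  by (simp add: SL2_mod_def)

lemma reduce_mod_carrier: "A \<in> carrier (SL2_mod N) \<Longrightarrow> reduce_mod N A = A"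
  by (simp add: SL2_mod_def reduce_mod_id)

lemma finite_SL2_mod: "finite (carrier (SL2_mod N))"
proof (rule finite_subset)
  let ?I = "{0..<int N}"
  show "carrier (SL2_mod N) \<subseteq> (\<lambda>(p, q, r, t). mat2 p q r t) ` (?I \<times> ?I \<times> ?I \<times> ?I)"
  proof
    fix M assume "M \<in> carrier (SL2_mod N)"
    then show "M \<in> (\<lambda>(p, q, r, t). mat2 p q r t) ` (?I \<times> ?I \<times> ?I \<times> ?I)"
      by (intro image_eqI[of _ _ "(M $ 1 $ 1, M $ 1 $ 2, M $ 2 $ 1, M $ 2 $ 2)"])
        (auto simp: mat2_eta SL2_mod_def)
  qed
qed auto

text \<open>The Euclidean algorithm on the first column. It runs on integer matrices whose
  determinant is only congruent to 1, so elements need not be lifted to determinant exactly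
  1.\<close>

lemma SL2_mod_generated:
  assumes N: "N \<ge> 1"
    and S: "reduce_mod N S_matrix \<in> H" and T: "reduce_mod N T_matrix \<in> H"
    and mult: "\<And>A B. A \<in> H \<Longrightarrow> B \<in> H \<Longrightarrow> A \<otimes>\<^bsub>SL2_mod N\<^esub> B \<in> H"
  shows "carrier (SL2_mod N) \<subseteq> H"
proof
  define K where "K A \<longleftrightarrow> reduce_mod N A \<in> H" for A
  have K_mult: "K (A ** B)" if "K A" "K B" for A B
    using mult[of "reduce_mod N A" "reduce_mod N B"] that
    by (simp add: K_def mult_SL2_mod reduce_mod_mult)
  have K_cong: "K A \<longleftrightarrow> K B" if "reduce_mod N A = reduce_mod N B" for A B
    using that by (simp add: K_def)
  have K_S: "K (mat2 0 (- 1) 1 0)" using S by (simp add: K_def S_matrix_eq)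
  have K_T_Suc: "K (mat2 1 (int n + 1) 0 1)" for n
  proof (induction n)
    case 0
    then show ?case using T by (simp add: K_def T_matrix_eq)
  next
    case (Suc n)
    from K_mult[OF this, of "mat2 1 1 0 1"] T show ?case
      by (simp add: K_def T_matrix_eq algebra_simps)
  qed
  have K_T: "K (mat2 1 n 0 1)" for n
  proof -
    \<comment> \<open>\<open>H\<close> is not assumed closed under inverses, so each exponent is
      replaced by a positive one in the same residue class.\<close>
    have "K (mat2 1 (n mod int N + int N) 0 1)"
      using K_T_Suc[of "nat (n mod int N + int N - 1)"] N
      by (simp add: add_nonneg_pos)
    moreover have "reduce_mod N (mat2 1 (n mod int N + int N) 0 1) = reduce_mod N (mat2 1 n 0 1)"
      by (simp add: reduce_mod_mat2_eq_iff cong_def)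
    ultimately show ?thesis using K_cong by blast
  qed
  \<comment> \<open>The square of \<open>S\<close> is -1, so its cube is its inverse.\<close>
  have K_S_inv: "K (mat2 0 1 (- 1) 0)"
    using K_mult[OF K_mult[OF K_S K_S] K_S] by simp
  have K_all: "K (mat2 p q r t)" if "[p * t - q * r = 1] (mod int N)" for p q r t
    using that
  proof (induction "nat \<bar>r\<bar>" arbitrary: p q r t rule: less_induct)
    case less
    show ?case
    proof (cases "r = 0")
      case True
      with less.prems have 1: "[p * t = 1] (mod int N)" by simp
      \<comment> \<open>The first five factors multiply to \<open>(0, -p; t, 0)\<close> modulo \<open>N\<close>.\<close>
      let ?M = "mat2 1 (- p) 0 1 ** mat2 0 (- 1) 1 0 ** mat2 1 (- t) 0 1 ** mat2 0 1 (- 1) 0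
        ** mat2 1 (- p) 0 1 ** mat2 0 1 (- 1) 0 ** mat2 1 (t * q) 0 1"
      have "K ?M" by (intro K_mult K_S K_T K_S_inv)
      moreover have "reduce_mod N ?M = reduce_mod N (mat2 p q r t)"
      proof -
        \<comment> \<open>\<open>c\<close> vanishes modulo \<open>N\<close>, and each entry of
          \<open>?M\<close> differs from the desired one by a multiple of \<open>c\<close>.\<close>
        define c where "c = p * t - 1"
        have c: "int N dvd c" using 1 by (simp add: c_def cong_iff_dvd_diff)
        have "?M = mat2 (p - p * c) ((p - p * c) * (t * q) - c) c (c * (t * q) + t)"
          by (simp add: mat2_eq_iff c_def algebra_simps)
        moreover have "(p - p * c) * (t * q) - c - q = c * (q - p * t * q - 1)"
          by (simp add: c_def algebra_simps)
        ultimately show ?thesis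
          using c True by (simp add: reduce_mod_mat2_eq_iff cong_iff_dvd_diff)
      qed
      ultimately show ?thesis using K_cong by blast
    next
      case False
      \<comment> \<open>Splitting off the left factor T^k S leaves a matrix of the same determinant
        whose lower left entry is minus the remainder of \<open>p\<close> by
        \<open>r\<close>.\<close>
      let ?k = "p div r"
      have "nat \<bar>- (p - ?k * r)\<bar> < nat \<bar>r\<bar>"
        using False abs_mod_less[of r p] by (simp add: minus_div_mult_eq_mod)
      then have "K (mat2 r t (- (p - ?k * r)) (- (q - ?k * t)))"
        using less.prems by (intro less.hyps) (auto simp: algebra_simps)
      then have "K (mat2 1 ?k 0 1 ** mat2 0 (- 1) 1 0 ** mat2 r t (- (p - ?k * r)) (- (q - ?k * t)))"
        by (intro K_mult K_T K_S)
      then show ?thesis by (simp add: algebra_simps)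
    qed
  qed
  fix M assume "M \<in> carrier (SL2_mod N)"
  then have "[det M = 1] (mod int N)" "reduce_mod N M = M"
    by (simp_all add: reduce_mod_carrier) (simp add: SL2_mod_def cong_def)
  then show "M \<in> H"
    using K_all[of "M $ 1 $ 1" "M $ 2 $ 2" "M $ 1 $ 2" "M $ 2 $ 1"]
    by (simp add: K_def mat2_eta det_2)
qed

text \<open>Conjugation by diag(a, 1) when \<open>b\<close> is inverse to \<open>a\<close> modulo
  \<open>N\<close>. Passing the inverse as an argument avoids choosing one.\<close>

definition twist :: "nat \<Rightarrow> int \<Rightarrow> int \<Rightarrow> int^2^2 \<Rightarrow> int^2^2" where
  "twist N a b M = reduce_mod N (mat2 (M $ 1 $ 1) (a * M $ 1 $ 2) (b * M $ 2 $ 1) (M $ 2 $ 2))"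

lemma twist_mat2: "twist N a b (mat2 p q r t) = reduce_mod N (mat2 p (a * q) (b * r) t)"
  by (simp add: twist_def)

lemma twist_reduce_mod: "twist N a b (reduce_mod N M) = twist N a b M"
  by (simp add: twist_def reduce_mod_mat2_eq_iff) (simp add: reduce_mod_def cong_def mod_mult_right_eq)

text \<open>In the diagonal entries of the product \<open>a\<close> and \<open>b\<close> meet and
  cancel; the other two entries carry a common factor \<open>a\<close> or \<open>b\<close>.\<close>

lemma twist_mult:
  assumes "[a * b = 1] (mod int N)"
  shows "twist N a b (A \<otimes>\<^bsub>SL2_mod N\<^esub> B) = twist N a b A \<otimes>\<^bsub>SL2_mod N\<^esub> twist N a b B"
proof -
  have *: "[a * y * (b * z) = y * z] (mod int N)" "[b * y * (a * z) = y * z] (mod int N)" for y z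
    using cong_mult[OF assms cong_refl[of "y * z"]] by (simp_all add: ac_simps)
  have "twist N a b (mat2 p q r t ** mat2 p' q' r' t') =
      reduce_mod N (twist N a b (mat2 p q r t) ** twist N a b (mat2 p' q' r' t'))" for p q r t p' q' r' t'
    unfolding twist_mat2 reduce_mod_mult mat2_mult reduce_mod_mat2_eq_iff
    by (intro conjI cong_add[OF cong_refl *(1)[THEN cong_sym]] cong_add[OF *(2)[THEN cong_sym] cong_refl])
      (simp_all add: algebra_simps)
  from this[of "A $ 1 $ 1" "A $ 1 $ 2" "A $ 2 $ 1" "A $ 2 $ 2" "B $ 1 $ 1" "B $ 1 $ 2" "B $ 2 $ 1" "B $ 2 $ 2"]
  show ?thesis by (simp add: mult_SL2_mod twist_reduce_mod mat2_eta)
qed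

lemma twist_in_carrier:
  assumes "N \<ge> 1" "[a * b = 1] (mod int N)" "A \<in> carrier (SL2_mod N)"
  shows "twist N a b A \<in> carrier (SL2_mod N)"
proof -
  have "[A $ 1 $ 1 * A $ 2 $ 2 - a * A $ 1 $ 2 * (b * A $ 2 $ 1) = A $ 1 $ 1 * A $ 2 $ 2 - 1 * (A $ 1 $ 2 * A $ 2 $ 1)] (mod int N)"
    using cong_diff[OF cong_refl cong_mult[OF assms(2) cong_refl]] by (fastforce simp: ac_simps)
  moreover have "[A $ 1 $ 1 * A $ 2 $ 2 - 1 * (A $ 1 $ 2 * A $ 2 $ 1) = 1] (mod int N)"
    using assms(3) by (simp add: SL2_mod_def det_2 cong_def)
  ultimately show ?thesis
    unfolding twist_def using assms(1) cong_trans by (intro reduce_mod_in_SL2_mod) (auto simp: cong_def)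
qed

lemma twist_twist:
  assumes "[a * b = 1] (mod int N)" "A \<in> carrier (SL2_mod N)"
  shows "twist N b a (twist N a b A) = A"
proof -
  have *: "[b * (a * x) = x] (mod int N)" "[a * (b * x) = x] (mod int N)" for x
    using cong_mult[OF assms(1) cong_refl[of x]] by (simp_all add: ac_simps)
  have "twist N b a (twist N a b A) = reduce_mod N (mat2 (A $ 1 $ 1) (A $ 1 $ 2) (A $ 2 $ 1) (A $ 2 $ 2))"
    unfolding twist_def[of N a b] twist_reduce_mod by (simp add: twist_mat2 reduce_mod_mat2_eq_iff *)
  then show ?thesis using reduce_mod_carrier[OF assms(2)] by (simp add: mat2_eta)
qed

lemma bij_betw_twist:
  assumes "N \<ge> 1" "[a * b = 1] (mod int N)"
  shows "bij_betw (twist N a b) (carrier (SL2_mod N)) (carrier (SL2_mod N))"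
proof -
  have "[b * a = 1] (mod int N)" using assms(2) by (simp add: mult.commute)
  then show ?thesis using assms
    by (intro bij_betw_byWitness[of _ "twist N b a"]) (auto simp: twist_twist twist_in_carrier)
qed

subsection \<open>Linear algebra\<close>

lemma matrix_vector_mult_axis_1:
  fixes M :: "'b::semiring_1^'n^'m"
  shows "M *v axis k 1 = column k M"
  by (simp add: vec_eq_iff matrix_vector_mult_def column_def axis_def if_distrib cong: if_cong)

text \<open>Multiplying the columns by a common denominator \<open>D\<close> of all entries makes
  them integral without changing their span; a maximal independent subset of them is the
  basis.\<close>

lemma defined_over_int_range_rational:
  fixes P :: "complex^'a::finite^'a"
  assumes "\<And>x y. P $ x $ y \<in> \<rat>"
  shows "defined_over_int (range ((*v) P))"
proof -
  have "\<exists>d::nat. d \<noteq> 0 \<and> of_nat d * P $ x $ y \<in> \<int>" for x y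
  proof -
    from assms obtain a b where "b > 0" "P $ x $ y = of_int a / of_int b"
      using Rats_cases' by metis
    then show ?thesis by (intro exI[of _ "nat b"]) auto
  qed
  then obtain d where d: "\<And>x y. d x y \<noteq> (0::nat)" "\<And>x y. of_nat (d x y) * P $ x $ y \<in> \<int>"
    by metis
  define D :: nat where "D = (\<Prod>x\<in>UNIV. \<Prod>y\<in>UNIV. d x y)"
  have "D \<noteq> 0" using d(1) by (simp add: D_def)
  have D: "of_nat D * P $ x $ y \<in> \<int>" for x y
  proof -
    have "d x y dvd D" unfolding D_def
      by (rule dvd_trans[OF _ dvd_prodI[of UNIV x]]) auto
    then obtain k where "D = k * d x y" by (metis dvdE mult.commute)
    then show ?thesis using Ints_mult[OF Ints_of_nat d(2)] by (simp add: mult.assoc)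
  qed
  let ?C = "range (\<lambda>y. of_nat D *s column y P)"
  have "vec.span ?C = range ((*v) P)"
  proof
    have "of_nat D *s column y P = P *v (of_nat D *s axis y 1)" for y
      by (simp add: vec.scale matrix_vector_mult_axis_1)
    then have "?C \<subseteq> range ((*v) P)" by auto
    moreover have "vec.subspace (range ((*v) P))"
      by (intro vec.subspace_image) auto
    ultimately show "vec.span ?C \<subseteq> range ((*v) P)" by (rule vec.span_minimal)
  next
    show "range ((*v) P) \<subseteq> vec.span ?C"
    proof safe
      fix v
      have "P *v v = (\<Sum>y\<in>UNIV. (v $ y / of_nat D) *s (of_nat D *s column y P))"
        using \<open>D \<noteq> 0\<close> by (simp add: matrix_mult_sum)
      also have "\<dots> \<in> vec.span ?C"
        by (intro vec.span_sum vec.span_scale vec.span_base) auto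
      finally show "P *v v \<in> vec.span ?C" .
    qed
  qed
  moreover obtain B where B: "B \<subseteq> ?C" "vec.independent B" "?C \<subseteq> vec.span B"
    using vec.maximal_independent_subset by metis
  moreover have "vec.span B = vec.span ?C"
    using B(1,3) by (intro equalityI vec.span_mono vec.span_minimal vec.subspace_span)
  moreover have "?C \<subseteq> integral_vectors"
    using D by (auto simp: integral_vectors_def column_def)
  ultimately show ?thesis
    unfolding defined_over_int_def by (intro exI[of _ B]) simp
qed

lemma sum_matrix_vector_mult: "(\<Sum>i\<in>I. M i) *v v = (\<Sum>i\<in>I. M i *v v)"
  for v :: "'b::ring_1^'n"
  by (induction I rule: infinite_finite_induct) (auto simp: matrix_vector_mult_add_rdistrib)

subsection \<open>The Weil representation\<close>

locale weil_module =
  fixes Q :: "'a::{finite,ab_group_add} \<Rightarrow> rat_mod_int"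
    and s :: int
    and \<rho> :: "int^2^2 \<Rightarrow> complex^'a::{finite,ab_group_add}^'a::{finite,ab_group_add}"
  assumes module: "finite_quadratic_module Q"
    and signature: "has_signature Q s"
    and weil: "weil_representation Q s \<rho>"
begin

abbreviation N :: nat where "N \<equiv> level Q"

abbreviation B :: "'a \<Rightarrow> 'a \<Rightarrow> rat_mod_int" where "B \<equiv> bilinear_form Q"

abbreviation G :: "(int^2^2) monoid" where "G \<equiv> SL2_mod N"

text \<open>The product of annihilators of all values of \<open>Q\<close> is a candidate for the
  level, so the \<open>LEAST\<close> has its defining property.\<close>

lemma level_pos: "N \<ge> 1" and level_Q: "int_multiple (int N) (Q x) = 0"
proof -
  obtain d where d: "\<And>q. d q \<ge> (1::nat)" "\<And>q. int_multiple (int (d q)) (q :: rat_mod_int) = 0"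
    using int_multiple_eq_0_exists by metis
  define D where "D = (\<Prod>x\<in>UNIV. d (Q x))"
  have "int_multiple (int D) (Q x) = 0" for x
  proof -
    have "d (Q x) dvd D" unfolding D_def by (intro dvd_prodI) auto
    then obtain k where "D = d (Q x) * k" by (rule dvdE)
    then have "int D = int k * int (d (Q x))" by simp
    then show ?thesis by (simp only: int_multiple_mult d(2) int_multiple_zero_right)
  qed
  moreover have "D \<ge> 1" unfolding D_def using d(1) by (intro prod_ge_1) auto
  ultimately have "D \<ge> 1 \<and> (\<forall>x. int_multiple (int D) (Q x) = 0)" by simp
  then have "N \<ge> 1 \<and> (\<forall>x. int_multiple (int N) (Q x) = 0)"
    unfolding level_def by (rule LeastI)
  then show "N \<ge> 1" "int_multiple (int N) (Q x) = 0" by auto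
qed

section \<open>The bilinear form and its characters\<close>

lemma level_B: "int_multiple (int N) (B x y) = 0"
  by (simp add: bilinear_form_def int_multiple_diff_right level_Q)

lemma B_add_left: "B (x + y) z = B x z + B y z"
  and B_add_right: "B x (y + z) = B x y + B x z"
  and Q_int_multiple: "Q (int_multiple n x) = int_multiple (n\<^sup>2) (Q x)"
  and B_nondegenerate: "(\<And>y. B x y = 0) \<Longrightarrow> x = 0"
  using module by (auto simp: finite_quadratic_module_def quadratic_form_def)

lemma B_commute: "B x y = B y x"
  by (simp add: bilinear_form_def add.commute)

lemma B_0 [simp]: "B 0 y = 0" "B x 0 = 0"
  using B_add_left[of 0 0 y] B_add_right[of x 0 0] by auto

lemma B_int_multiple_right: "B x (int_multiple n y) = int_multiple n (B x y)"
proof (induction n rule: int_induct[where k = 0])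
  case (step1 i)
  then show ?case by (simp add: int_multiple_add B_add_right)
next
  case (step2 i)
  then show ?case using int_multiple_add[of "i - 1" 1 y] int_multiple_add[of "i - 1" 1 "B x y"]
    by (simp add: B_add_right)
qed simp

lemma Q_add: "Q (x + y) = Q x + Q y + B x y"
  by (simp add: bilinear_form_def)

lemma Q_0 [simp]: "Q 0 = 0"
  using Q_int_multiple[of 0 0] by simp

text \<open>Orthogonality of characters. For \<open>u\<close> nonzero the character is nontrivial,
  by non-degeneracy and invertibility of \<open>a\<close> modulo the level; shifting by a
  \<open>w0\<close> where it is not 1 forces the sum to vanish.\<close>

lemma e_mult_B_sum:
  assumes "coprime a (int N)"
  shows "(\<Sum>w\<in>UNIV. e_mult a (B u w)) = (if u = 0 then of_nat CARD('a) else 0)"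
proof (cases "u = 0")
  case False
  obtain b where b: "[b * a = 1] (mod int N)"
    using cong_solve_coprime_int[OF assms] by (auto simp: mult.commute)
  obtain w0 where "B u w0 \<noteq> 0" using B_nondegenerate False by blast
  moreover have "B u w0 = int_multiple b (int_multiple a (B u w0))"
    using int_multiple_cong[OF b level_B] by (simp add: int_multiple_mult)
  ultimately have "e_mult a (B u w0) \<noteq> 1"
    unfolding e_mult_def e_eq_1_iff by auto
  moreover have "(\<Sum>w\<in>UNIV. e_mult a (B u w)) = (\<Sum>w\<in>UNIV. e_mult a (B u (w + w0)))"
    by (rule sum.reindex_bij_witness[of _ "\<lambda>w. w + w0" "\<lambda>w. w - w0"]) auto
  then have "(\<Sum>w\<in>UNIV. e_mult a (B u w)) = (\<Sum>w\<in>UNIV. e_mult a (B u w)) * e_mult a (B u w0)"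
    unfolding sum_distrib_right by (simp add: B_add_right e_mult_add)
  ultimately show ?thesis using False by simp
qed simp

section \<open>Gauss sums of the forms a Q\<close>

definition gauss :: "int \<Rightarrow> complex" where
  "gauss a = (\<Sum>x\<in>UNIV. e_mult a (Q x))"

text \<open>Substituting z = u + w makes the inner sum over \<open>w\<close> a character sum, which
  leaves only u = 0.\<close>

lemma gauss_norm:
  assumes "coprime a (int N)"
  shows "gauss a * cnj (gauss a) = of_nat CARD('a)"
proof -
  have "gauss a * cnj (gauss a) = (\<Sum>w\<in>UNIV. \<Sum>z\<in>UNIV. e_mult a (Q z) * cnj (e_mult a (Q w)))"
    unfolding gauss_def cnj_sum sum_product by (rule sum.swap)
  also have "\<dots> = (\<Sum>w\<in>UNIV. \<Sum>u\<in>UNIV. e_mult a (Q (u + w)) * cnj (e_mult a (Q w)))"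
  proof (rule sum.cong[OF refl])
    fix w
    show "(\<Sum>z\<in>UNIV. e_mult a (Q z) * cnj (e_mult a (Q w))) = (\<Sum>u\<in>UNIV. e_mult a (Q (u + w)) * cnj (e_mult a (Q w)))"
      by (rule sum.reindex_bij_witness[of _ "\<lambda>u. u + w" "\<lambda>u. u - w"]) auto
  qed
  also have "\<dots> = (\<Sum>w\<in>UNIV. \<Sum>u\<in>UNIV. e_mult a (Q u) * e_mult a (B u w))"
    by (intro sum.cong refl) (simp add: Q_add e_mult_add mult_ac)
  also have "\<dots> = (\<Sum>u\<in>UNIV. e_mult a (Q u) * (\<Sum>w\<in>UNIV. e_mult a (B u w)))"
    by (subst sum.swap) (simp add: sum_distrib_left)
  also have "\<dots> = of_nat CARD('a)"
    by (simp add: e_mult_B_sum[OF assms] if_distrib cong: if_cong)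
  finally show ?thesis .
qed

text \<open>By definition of the signature, \<open>gauss 1\<close> is the square root of |A| times
  e(s/8). In the new form neither the square root nor the eighth root of unity occurs, only values
  of \<open>e\<close> on \<open>Q\<close> and a rational factor.\<close>

lemma weil_constant:
  "exp (- (2 * of_real pi * \<i> * (of_int s / 8))) / of_real (sqrt (real CARD('a))) = cnj (gauss 1) / of_nat CARD('a)"
proof -
  let ?r = "sqrt (real CARD('a))"
  have r: "?r \<noteq> 0" "of_real ?r * of_real ?r = (of_nat CARD('a) :: complex)"
    by (simp_all flip: of_real_mult)
  have "gauss 1 = of_real ?r * exp (2 * of_real pi * \<i> * (of_int s / 8))"
    using signature r(1) by (simp add: has_signature_def gauss_def e_mult_def field_simps)
  then have "cnj (gauss 1) = of_real ?r * exp (- (2 * of_real pi * \<i> * (of_int s / 8)))"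
    by (simp add: exp_cnj)
  then show ?thesis using r(1) by (simp add: field_simps flip: r(2))
qed

text \<open>The Weil representation of the module with quadratic form \<open>a Q\<close>, written with the
  Gauss sum in place of the signature so that its entries are conjugate families in \<open>a\<close>.\<close>

definition weil_T :: "int \<Rightarrow> complex^'a::{finite,ab_group_add}^'a::{finite,ab_group_add}" where
  "weil_T a = (\<chi> y x. if x = y then e_mult a (Q x) else 0)"

definition weil_S :: "int \<Rightarrow> complex^'a::{finite,ab_group_add}^'a::{finite,ab_group_add}" where
  "weil_S a = (\<chi> y x. cnj (gauss a) / of_nat CARD('a) * cnj (e_mult a (B x y)))"

section \<open>Values of \<rho> on the generators and their twists\<close>

lemma rho_mult: "g \<in> carrier G \<Longrightarrow> h \<in> carrier G \<Longrightarrow> \<rho> (g \<otimes>\<^bsub>G\<^esub> h) = \<rho> g ** \<rho> h"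
  and rho_invertible: "g \<in> carrier G \<Longrightarrow> invertible (\<rho> g)"
  using weil by (auto simp: weil_representation_def hom_def GL_def Pi_def)

lemma rho_S: "\<rho> (reduce_mod N S_matrix) = weil_S 1"
proof -
  have "\<rho> (reduce_mod N S_matrix) $ y $ x = weil_S 1 $ y $ x" for x y
  proof -
    have "\<rho> (reduce_mod N S_matrix) *v axis x 1 = (cnj (gauss 1) / of_nat CARD('a)) *s
        (\<Sum>y\<in>UNIV. e (- B x y) *s axis y 1)"
      using weil weil_constant by (simp add: weil_representation_def)
    from arg_cong[OF this[unfolded matrix_vector_mult_axis_1], of "\<lambda>v. v $ y"] show ?thesis
      by (simp add: column_def weil_S_def e_mult_def e_minus axis_def if_distrib cong: if_cong)
  qed
  then show ?thesis by (simp add: vec_eq_iff)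
qed

lemma rho_T: "\<rho> (reduce_mod N T_matrix) = weil_T 1"
proof -
  have "\<rho> (reduce_mod N T_matrix) $ y $ x = weil_T 1 $ y $ x" for x y
  proof -
    have "\<rho> (reduce_mod N T_matrix) *v axis x 1 = e (Q x) *s axis x 1"
      using weil by (simp add: weil_representation_def)
    from arg_cong[OF this[unfolded matrix_vector_mult_axis_1], of "\<lambda>v. v $ y"] show ?thesis
      by (auto simp: column_def weil_T_def e_mult_def axis_def)
  qed
  then show ?thesis by (simp add: vec_eq_iff)
qed

lemma carrier_mat2: "[p * t - q * r = 1] (mod int N) \<Longrightarrow> reduce_mod N (mat2 p q r t) \<in> carrier G"
  using level_pos by (intro reduce_mod_in_SL2_mod) (auto simp: cong_def)

lemma rho_reduce_mod_mult:
  assumes "reduce_mod N A \<in> carrier G" "reduce_mod N B' \<in> carrier G"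
  shows "\<rho> (reduce_mod N (A ** B')) = \<rho> (reduce_mod N A) ** \<rho> (reduce_mod N B')"
  using rho_mult[OF assms] by (simp add: mult_SL2_mod reduce_mod_mult)

lemma weil_T_mult: "(weil_T a ** M) $ x $ y = e_mult a (Q x) * M $ x $ y"
  and mult_weil_T: "(M ** weil_T a) $ x $ y = M $ x $ y * e_mult a (Q y)"
  by (simp_all add: weil_T_def matrix_matrix_mult_def if_distrib if_distribR cong: if_cong)

lemma rho_T_power: "\<rho> (reduce_mod N (mat2 1 a 0 1)) = weil_T a"
proof -
  \<comment> \<open>The induction starts at exponent 1, where the value is prescribed, rather than
    at the identity; hence also the representative \<open>?a\<close>, which is at least 1.\<close>
  have Suc: "\<rho> (reduce_mod N (mat2 1 (int n + 1) 0 1)) = weil_T (int n + 1)" for n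
  proof (induction n)
    case 0
    then show ?case using rho_T by (simp add: T_matrix_eq)
  next
    case (Suc n)
    have "\<rho> (reduce_mod N (mat2 1 (int (Suc n) + 1) 0 1)) =
        \<rho> (reduce_mod N (mat2 1 1 0 1 ** mat2 1 (int n + 1) 0 1))"
      by (simp add: algebra_simps)
    also have "\<dots> = weil_T 1 ** weil_T (int n + 1)"
      using Suc rho_T by (subst rho_reduce_mod_mult) (simp_all add: T_matrix_eq carrier_mat2)
    also have "\<dots> = weil_T (int (Suc n) + 1)"
      unfolding vec_eq_iff weil_T_mult
      by (simp add: weil_T_def e_mult_add_left[of 1] add.commute[of 1] flip: e_mult_add_left)
    finally show ?case .
  qed
  let ?a = "a mod int N + int N"
  have "[?a = a] (mod int N)" by (simp add: cong_def)
  then have "reduce_mod N (mat2 1 a 0 1) = reduce_mod N (mat2 1 ?a 0 1)"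
    by (simp add: reduce_mod_mat2_eq_iff cong_sym)
  moreover have "e_mult ?a (Q x) = e_mult a (Q x)" for x
    unfolding e_mult_def using int_multiple_cong[OF \<open>[?a = a] (mod int N)\<close> level_Q] by simp
  then have "weil_T a = weil_T ?a"
    by (simp add: weil_T_def vec_eq_iff)
  ultimately show ?thesis
    using Suc[of "nat (?a - 1)"] level_pos by (simp add: add_nonneg_pos)
qed

text \<open>Completing the square: the exponent -a B(z,x) + a Q(z) - B(z,y) equals a Q(z-u) - a Q(u)
  with u = x + b y. Summing over \<open>z\<close> gives \<open>gauss a\<close>, which together with
  its conjugate from \<open>weil_S a\<close> cancels a factor |A|.\<close>

lemma weil_S_weil_T_weil_S:
  assumes ab: "[a * b = 1] (mod int N)"
  shows "weil_S a ** weil_T a ** weil_S 1 = weil_T (- a) ** weil_S 1 ** weil_T (- b)"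
proof -
  let ?n = "of_nat CARD('a) :: complex"
  have cop: "coprime a (int N)" using ab coprime_iff_invertible_int by blast
  have "(weil_S a ** weil_T a ** weil_S 1) $ x $ y =
      (weil_T (- a) ** weil_S 1 ** weil_T (- b)) $ x $ y" for x y
  proof -
    \<comment> \<open>Since a b is 1 modulo the level, B(z,y) = a B(z, b y), so the two linear terms
      combine to a B(z,u).\<close>
    define u where "u = x + int_multiple b y"
    have Ba: "e_mult 1 (B z y) = e_mult a (B z (int_multiple b y))" for z
      unfolding e_mult_def B_int_multiple_right int_multiple_mult[symmetric]
      using int_multiple_cong[OF ab level_B] by simp
    have Qa: "e_mult a (Q (int_multiple b y)) = e_mult b (Q y)"
    proof -
      have "[a * b\<^sup>2 = b] (mod int N)"
        using cong_mult[OF ab cong_refl[of b]] by (simp add: power2_eq_square mult_ac)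
      then show ?thesis
        unfolding e_mult_def Q_int_multiple int_multiple_mult[symmetric]
        by (intro arg_cong[of _ _ e] int_multiple_cong[OF _ level_Q])
    qed
    have u: "e_mult a (Q u) = e_mult a (Q x) * e_mult b (Q y) * e_mult 1 (B x y)"
      by (simp add: u_def Q_add e_mult_add Qa Ba)
    have shift: "cnj (e_mult a (B z x)) * e_mult a (Q z) * cnj (e_mult 1 (B z y)) =
        cnj (e_mult a (Q u)) * e_mult a (Q (z - u))" for z
    proof -
      \<comment> \<open>Compare Q(2u) = 4 Q(u) with Q(u + u) = 2 Q(u) + B(u,u).\<close>
      have Buu: "B u u = Q u + Q u"
        using Q_int_multiple[of 2 u] int_multiple_add[of 1 1 u] int_multiple_add[of 1 1 "Q u"]
          int_multiple_add[of 2 2 "Q u"] by (simp add: Q_add)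
      have Bzu: "e_mult a (B z u) = e_mult a (B z x) * e_mult 1 (B z y)"
        by (simp add: u_def B_add_right e_mult_add Ba)
      have "Q z = Q (z - u) - Q u + B z u"
        using Q_add[of "z - u" u] B_add_left[of "z - u" u u] by (simp add: Buu algebra_simps)
      then have "e_mult a (Q z) = e_mult a (Q (z - u)) * cnj (e_mult a (Q u)) * (e_mult a (B z x) * e_mult 1 (B z y))"
        by (simp add: e_mult_add e_mult_minus Bzu flip: add_uminus_conv_diff)
      then have "cnj (e_mult a (B z x)) * e_mult a (Q z) * cnj (e_mult 1 (B z y)) =
          (e_mult a (B z x) * cnj (e_mult a (B z x))) * (e_mult 1 (B z y) * cnj (e_mult 1 (B z y))) *
          (cnj (e_mult a (Q u)) * e_mult a (Q (z - u)))"
        by (simp only: mult_ac)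
      then show ?thesis by simp
    qed
    have "(\<Sum>z\<in>UNIV. e_mult a (Q (z - u))) = gauss a"
      unfolding gauss_def by (rule sum.reindex_bij_witness[of _ "\<lambda>z. z + u" "\<lambda>z. z - u"]) auto
    then have sum: "(\<Sum>z\<in>UNIV. cnj (e_mult a (B z x)) * e_mult a (Q z) * cnj (e_mult 1 (B z y))) =
        cnj (e_mult a (Q u)) * gauss a"
      unfolding shift by (simp flip: sum_distrib_left)
    have "(weil_S a ** weil_T a ** weil_S 1) $ x $ y =
        (\<Sum>z\<in>UNIV. (weil_S a ** weil_T a) $ x $ z * weil_S 1 $ z $ y)"
      by (simp add: matrix_matrix_mult_def)
    also have "\<dots> = (\<Sum>z\<in>UNIV. cnj (gauss a) / ?n * (cnj (gauss 1) / ?n) *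
        (cnj (e_mult a (B z x)) * e_mult a (Q z) * cnj (e_mult 1 (B z y))))"
      unfolding mult_weil_T by (simp add: weil_S_def B_commute[of y] mult_ac)
    also have "\<dots> = cnj (gauss a) / ?n * (cnj (gauss 1) / ?n) * (cnj (e_mult a (Q u)) * gauss a)"
      unfolding sum_distrib_left[symmetric] sum ..
    also have "\<dots> = (gauss a * cnj (gauss a)) / ?n * (cnj (gauss 1) / ?n) * cnj (e_mult a (Q u))"
      by simp
    also have "\<dots> = (cnj (gauss 1) / ?n) * cnj (e_mult a (Q u))"
      unfolding gauss_norm[OF cop] by simp
    also have "\<dots> = (weil_T (- a) ** weil_S 1 ** weil_T (- b)) $ x $ y"
      unfolding weil_T_mult mult_weil_T by (simp add: weil_S_def u e_mult_uminus B_commute[of y] mult_ac)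
    finally show ?thesis .
  qed
  then show ?thesis by (simp add: vec_eq_iff)
qed

text \<open>The twist of \<open>S\<close> is (0, -a; b, 0), and its product with T^a S is T^(-a) S
  T^(-b) modulo \<open>N\<close>. Applying \<rho> gives the relation that \<open>weil_S a\<close>
  satisfies, and the common right factor is invertible.\<close>

lemma rho_twist_S:
  assumes ab: "[a * b = 1] (mod int N)"
  shows "\<rho> (twist N a b (reduce_mod N S_matrix)) = weil_S a"
proof -
  let ?X = "\<rho> (twist N a b (reduce_mod N S_matrix))"
  have tw: "twist N a b (reduce_mod N S_matrix) = reduce_mod N (mat2 0 (- a) b 0)"
    by (simp add: twist_reduce_mod S_matrix_eq twist_mat2)
  have c: "reduce_mod N (mat2 0 (- a) b 0) \<in> carrier G" "reduce_mod N (mat2 0 (- 1) 1 0) \<in> carrier G"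
    "reduce_mod N (mat2 1 t 0 1) \<in> carrier G" for t
    using ab by (auto intro: carrier_mat2)
  have c2: "reduce_mod N (mat2 0 (- a) b 0 ** mat2 1 a 0 1) \<in> carrier G"
    "reduce_mod N (mat2 1 (- a) 0 1 ** mat2 0 (- 1) 1 0) \<in> carrier G"
    using ab by (auto intro: carrier_mat2)
  have S: "\<rho> (reduce_mod N (mat2 0 (- 1) 1 0)) = weil_S 1" using rho_S by (simp add: S_matrix_eq)
  have "?X ** weil_T a ** weil_S 1 = \<rho> (reduce_mod N (mat2 0 (- a) b 0 ** mat2 1 a 0 1 ** mat2 0 (- 1) 1 0))"
    using c c2 S by (simp only: tw rho_reduce_mod_mult rho_T_power)
  also have "\<dots> = \<rho> (reduce_mod N (mat2 1 (- a) 0 1 ** mat2 0 (- 1) 1 0 ** mat2 1 (- b) 0 1))"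
  proof -
    have "[b * a = 1] (mod int N)" "[a * b - 1 = 0] (mod int N)" "[0 = a * b - 1] (mod int N)"
      using ab by (simp_all add: mult.commute cong_iff_dvd_diff dvd_diff_commute)
    then show ?thesis by (intro arg_cong[of _ _ \<rho>]) (simp add: reduce_mod_mat2_eq_iff)
  qed
  also have "\<dots> = weil_T (- a) ** weil_S 1 ** weil_T (- b)"
    using c c2 S by (simp only: rho_reduce_mod_mult rho_T_power)
  also have "\<dots> = weil_S a ** weil_T a ** weil_S 1"
    using weil_S_weil_T_weil_S[OF ab] by simp
  finally have eq: "?X ** (weil_T a ** weil_S 1) = weil_S a ** (weil_T a ** weil_S 1)"
    by (simp add: matrix_mul_assoc)
  have "invertible (weil_T a ** weil_S 1)"
    using rho_invertible[OF c(2)] rho_invertible[OF c(3)[of a]]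
    by (simp add: S rho_T_power invertible_mult)
  then obtain Y where "(weil_T a ** weil_S 1) ** Y = mat 1" by (auto simp: invertible_def)
  with arg_cong[OF eq, of "\<lambda>M. M ** Y"] show ?thesis
    by (simp flip: matrix_mul_assoc)
qed

lemma rho_twist_T: "\<rho> (twist N a b (reduce_mod N T_matrix)) = weil_T a"
  using rho_T_power[of a] by (simp add: twist_reduce_mod T_matrix_eq twist_mat2)

text \<open>Ties two descriptions of \<open>F a\<close> together: entrywise it is the Galois
  conjugate of index \<open>a\<close>, and it is also the value of \<rho> at the twisted element.
  The second is required only for \<open>a\<close> prime to the level.\<close>

definition conjugates :: "(nat \<Rightarrow> complex^'a::{finite,ab_group_add}^'a::{finite,ab_group_add}) \<Rightarrow> int^2^2 \<Rightarrow> bool" where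
  "conjugates F g \<longleftrightarrow> (\<forall>x y. conjugate_family N (\<lambda>a. F a $ x $ y)) \<and>
     (\<forall>a b. [int a * b = 1] (mod int N) \<longrightarrow> F a = \<rho> (twist N (int a) b g))"

lemma conjugates_mult:
  assumes "g \<in> carrier G" "h \<in> carrier G" and F: "conjugates F g" and H: "conjugates H h"
  shows "conjugates (\<lambda>a. F a ** H a) (g \<otimes>\<^bsub>G\<^esub> h)"
  unfolding conjugates_def
proof (intro conjI allI impI)
  show "conjugate_family N (\<lambda>a. (F a ** H a) $ x $ y)" for x y
    using F H by (simp add: conjugates_def matrix_matrix_mult_def conjugate_family_sum conjugate_family_mult)
next
  fix a b
  assume ab: "[int a * b = 1] (mod int N)"
  then have "F a = \<rho> (twist N (int a) b g)" "H a = \<rho> (twist N (int a) b h)"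
    using F H by (simp_all add: conjugates_def)
  then show "F a ** H a = \<rho> (twist N (int a) b (g \<otimes>\<^bsub>G\<^esub> h))"
    unfolding twist_mult[OF ab] using assms(1,2) ab level_pos
    by (simp only: rho_mult twist_in_carrier)
qed

lemma conjugates_T: "conjugates (\<lambda>a. weil_T (int a)) (reduce_mod N T_matrix)"
  unfolding conjugates_def
proof (intro conjI allI)
  show "conjugate_family N (\<lambda>a. weil_T (int a) $ x $ y)" for x y
    using conjugate_family_e[OF level_Q] conjugate_family_const[of 0]
    by (cases "x = y") (simp_all add: weil_T_def e_mult_def)
qed (simp add: rho_twist_T)

lemma conjugates_S: "conjugates (\<lambda>a. weil_S (int a)) (reduce_mod N S_matrix)"
  unfolding conjugates_def
proof (intro conjI allI)
  fix x y
  \<comment> \<open>The complex conjugations in \<open>weil_S\<close> are absorbed by passing to -Q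
    and -B.\<close>
  have "conjugate_family N (\<lambda>a. 1 / of_nat CARD('a) * ((\<Sum>z\<in>UNIV. e (int_multiple (int a) (- Q z))) *
      e (int_multiple (int a) (- B y x))))"
    by (intro conjugate_family_mult conjugate_family_sum conjugate_family_e conjugate_family_const)
      (simp_all add: int_multiple_minus_right level_Q level_B)
  then show "conjugate_family N (\<lambda>a. weil_S (int a) $ x $ y)"
    by (simp add: weil_S_def gauss_def e_mult_def int_multiple_minus_right e_minus)
qed (simp add: rho_twist_S)

text \<open>The property holds for both generators and passes to products. Membership in the group
  is kept in the set because \<open>conjugates_mult\<close> requires it.\<close>

lemma conjugates_exists:
  assumes "g \<in> carrier G"
  shows "\<exists>F. conjugates F g"
proof -
  interpret group G by (rule group_SL2_mod[OF level_pos])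
  have "carrier G \<subseteq> {g \<in> carrier G. \<exists>F. conjugates F g}"
  proof (rule SL2_mod_generated[OF level_pos])
    fix g h
    assume "g \<in> {g \<in> carrier G. \<exists>F. conjugates F g}" "h \<in> {g \<in> carrier G. \<exists>F. conjugates F g}"
    then show "g \<otimes>\<^bsub>G\<^esub> h \<in> {g \<in> carrier G. \<exists>F. conjugates F g}"
      using conjugates_mult by blast
  qed (use S_T_in_SL2_mod[OF level_pos] conjugates_S conjugates_T in blast)+
  then show ?thesis using assms by blast
qed

text \<open>Every conjugate of the entry equals the entry itself, since twisting only permutes the
  summands.\<close>

lemma sum_rho_rational: "(\<Sum>g\<in>carrier G. \<rho> g) $ x $ y \<in> \<rat>"
proof -
  obtain F where F: "\<And>g. g \<in> carrier G \<Longrightarrow> conjugates (F g) g"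
    using conjugates_exists by metis
  have "conjugate_family N (\<lambda>a. \<Sum>g\<in>carrier G. F g a $ x $ y)"
    using F by (intro conjugate_family_sum) (simp add: conjugates_def)
  moreover have "N > 0" using level_pos by simp
  moreover have "(\<Sum>g\<in>carrier G. F g a $ x $ y) = (\<Sum>g\<in>carrier G. \<rho> g) $ x $ y" if a: "coprime a N" for a
  proof -
    obtain b where b: "[int a * b = 1] (mod int N)"
      using cong_solve_coprime_int[of "int a" "int N"] a by auto
    have "(\<Sum>g\<in>carrier G. F g a $ x $ y) = (\<Sum>g\<in>carrier G. \<rho> (twist N (int a) b g) $ x $ y)"
      using F b by (intro sum.cong) (simp_all add: conjugates_def)
    also have "\<dots> = (\<Sum>g\<in>carrier G. \<rho> g $ x $ y)"
      using bij_betw_twist[OF level_pos b] by (rule sum.reindex_bij_betw)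
    finally show ?thesis by simp
  qed
  ultimately show ?thesis by (rule conjugate_family_fixed_rational)
qed

text \<open>Left translation permutes the summands, so the range is invariant. On an invariant
  vector the sum acts as the group order, so dividing by that order gives a preimage.\<close>

lemma range_sum_rho: "range ((*v) (\<Sum>g\<in>carrier G. \<rho> g)) = invariants N \<rho>"
proof -
  interpret group G by (rule group_SL2_mod[OF level_pos])
  let ?P = "\<Sum>g\<in>carrier G. \<rho> g"
  have "\<rho> h *v (?P *v v) = ?P *v v" if h: "h \<in> carrier G" for h v
  proof -
    have "\<rho> h *v (?P *v v) = (\<Sum>g\<in>carrier G. \<rho> h *v (\<rho> g *v v))"
      unfolding sum_matrix_vector_mult by (rule vec.sum)
    also have "\<dots> = (\<Sum>g\<in>carrier G. \<rho> (h \<otimes>\<^bsub>G\<^esub> g) *v v)"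
      using h by (intro sum.cong) (simp_all add: rho_mult matrix_vector_mul_assoc)
    also have "\<dots> = (\<Sum>g\<in>carrier G. \<rho> g *v v)"
      using h by (intro sum.reindex_bij_betw[of _ _ _ "\<lambda>g. \<rho> g *v v"]) (simp add: bij_betw_def inj_on_cmult surj_const_mult)
    finally show ?thesis by (simp add: sum_matrix_vector_mult)
  qed
  moreover have "v \<in> range ((*v) ?P)" if v: "v \<in> invariants N \<rho>" for v
  proof -
    let ?n = "of_nat (card (carrier G)) :: complex"
    have n: "?n \<noteq> 0" using finite_SL2_mod[of N] one_closed by (auto simp: card_eq_0_iff)
    have "?P *v v = (\<Sum>g\<in>carrier G. v)"
      unfolding sum_matrix_vector_mult using v by (intro sum.cong) (auto simp: invariants_def)
    also have "\<dots> = ?n *s v" by (simp add: vec_eq_iff del: sum_constant) simp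
    finally have "?P *v v = ?n *s v" .
    then have "?P *v (inverse ?n *s v) = v" using n by (simp add: vec.scale)
    then show ?thesis by (metis rangeI)
  qed
  ultimately show ?thesis by (auto simp: invariants_def)
qed

end

theorem theorem3p3:
  fixes Q :: "'a::{finite,ab_group_add} \<Rightarrow> rat_mod_int"
    and N :: nat
    and s :: int
    and \<rho> :: "int^2^2 \<Rightarrow> complex^'a::{finite,ab_group_add}^'a::{finite,ab_group_add}"
  assumes "finite_quadratic_module Q"
    and "N = level Q"
    and "has_signature Q s" and "even s"
    and "weil_representation Q s \<rho>"
  shows "defined_over_int (invariants N \<rho>)"
proof -
  interpret weil_module Q s \<rho>
    using assms by unfold_locales
  show ?thesis
    using defined_over_int_range_rational[OF sum_rho_rational] assms(2) by (simp add: range_sum_rho)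
qed

end
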